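(* Let $X$ be a normed space, $A\subset X$, $f\in X^*$, $0<\alpha<\|f\|_*$, and $\lambda>0$. Then $$AE(A,\mathcal{K}_{f,\alpha},\lambda)=\{x\in A:\ p_{f,\alpha}(x'-x)\geq-\lambda\ \ \forall x'\in A\}.$$
   Context: $X$ is a real normed space with dual $X^*$ and dual norm $\|\cdot\|_*$. A co-radiant set is a set $\mathcal{C}\subset X$ with $\mathcal{C}\ne\emptyset$, $\mathcal{C}\neq X$ (proper) and $\lambda x\in\mathcal{C}$ for all $\lambda\ge1$, $x\in\mathcal{C}$. For $\varepsilon>0$, $\mathcal{C}(\varepsilon):=\varepsilon\,\mathcal{C}$. A set $S$ is pointed if $S\cap(-S)\subset\{0_X\}$. For a proper pointed co-radiant set $\mathcal{C}$, $A\subset X$ and $\varepsilon>0$, a point $x_0\in A$ is an $\varepsilon$-efficient point with respect to $\mathcal{C}$, written $x_0\in AE(A,\mathcal{C},\varepsilon)$, if $(A-x_0)\cap(-\mathcal{C}(\varepsilon))\subset\{0_X\}$. For $f\in X^*$ and $0<\alpha<\|f\|_*$: $\mathcal{K}_{f,\alpha}:=\{x\in X: f(x)-\alpha\|x\|>1\}$ (a proper pointed co-radiant set). For $f\in X^*$, $\alpha>0$: $p_{f,\alpha}(x):=f(x)+\alpha\|x\|$ for $x\in X$. *)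

theory Defs
  imports "HOL-Analysis.Bounded_Linear_Function"
begin

text \<open>
  The dual of a real normed space \<open>'a\<close> is the type of bounded linear functionals
  \<open>'a \<Rightarrow>\<^sub>L real\<close>; its library norm (the operator norm) is the dual norm.
\<close>

definition co_radiant :: "'a::real_vector set \<Rightarrow> bool"
  where "co_radiant C \<longleftrightarrow>
    C \<noteq> {} \<and> C \<noteq> UNIV \<and> (\<forall>t::real. t \<ge> 1 \<longrightarrow> (\<forall>x\<in>C. t *\<^sub>R x \<in> C))"

definition pointed :: "'a::real_vector set \<Rightarrow> bool"
  where "pointed S \<longleftrightarrow> S \<inter> uminus ` S \<subseteq> {0}"

definition dilate :: "'a::real_vector set \<Rightarrow> real \<Rightarrow> 'a set"
  where "dilate C \<epsilon> = (\<lambda>x. \<epsilon> *\<^sub>R x) ` C"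

text \<open>
  The set of \<open>\<epsilon>\<close>-efficient points of \<open>A\<close>. The notion is intended for \<open>\<epsilon> > 0\<close> and
  pointed co-radiant \<open>C\<close>; the defining formula is used without these guards, which hold
  for the sets \<open>conic_K f \<alpha>\<close> below by \<open>co_radiant_conic_K\<close> and \<open>pointed_conic_K\<close>.
\<close>

definition AE :: "'a::real_vector set \<Rightarrow> 'a set \<Rightarrow> real \<Rightarrow> 'a set"
  where "AE A C \<epsilon> =
    {x\<^sub>0 \<in> A. (\<lambda>a. a - x\<^sub>0) ` A \<inter> uminus ` dilate C \<epsilon> \<subseteq> {0}}"

definition conic_K :: "('a::real_normed_vector \<Rightarrow>\<^sub>L real) \<Rightarrow> real \<Rightarrow> 'a set"
  where "conic_K f \<alpha> = {x. blinfun_apply f x - \<alpha> * norm x > 1}"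

definition conic_p :: "('a::real_normed_vector \<Rightarrow>\<^sub>L real) \<Rightarrow> real \<Rightarrow> 'a \<Rightarrow> real"
  where "conic_p f \<alpha> x = blinfun_apply f x + \<alpha> * norm x"

lemma pointed_conic_K:
  assumes "0 < \<alpha>"
  shows "pointed (conic_K f \<alpha>)"
proof -
  have False if "x \<in> conic_K f \<alpha>" "- x \<in> conic_K f \<alpha>" for x
  proof -
    have "0 \<le> \<alpha> * norm x" using assms by simp
    with that show False by (simp add: conic_K_def blinfun.minus_right)
  qed
  then show ?thesis by (auto simp: pointed_def)
qed

lemma co_radiant_conic_K:
  assumes "0 < \<alpha>" "\<alpha> < norm f"
  shows "co_radiant (conic_K f \<alpha>)"
proof -
  obtain x where x: "\<alpha> * norm x < norm (blinfun_apply f x)"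
    using norm_blinfun_bound[of \<alpha> f] assms by (meson not_less less_imp_le)
  define y where "y = (if blinfun_apply f x < 0 then - x else x)"
  define d where "d = blinfun_apply f y - \<alpha> * norm y"
  have d: "d > 0"
    using x by (auto simp: d_def y_def blinfun.minus_right split: if_splits)
  have "blinfun_apply f ((2 / d) *\<^sub>R y) - \<alpha> * norm ((2 / d) *\<^sub>R y) = (2 / d) * d"
    using d by (simp add: d_def blinfun.scaleR_right right_diff_distrib diff_divide_distrib)
  then have "(2 / d) *\<^sub>R y \<in> conic_K f \<alpha>"
    using d by (simp add: conic_K_def)
  then have 1: "conic_K f \<alpha> \<noteq> {}" by blast
  have "0 \<notin> conic_K f \<alpha>" by (simp add: conic_K_def)
  then have 2: "conic_K f \<alpha> \<noteq> UNIV" by blast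
  have "l *\<^sub>R x \<in> conic_K f \<alpha>" if "l \<ge> 1" "x \<in> conic_K f \<alpha>" for l x
  proof -
    have v: "blinfun_apply f x - \<alpha> * norm x > 1"
      using that(2) by (simp add: conic_K_def)
    then have "1 * (blinfun_apply f x - \<alpha> * norm x) \<le> l * (blinfun_apply f x - \<alpha> * norm x)"
      using that(1) by (intro mult_right_mono) auto
    with v have "1 < l * (blinfun_apply f x - \<alpha> * norm x)"
      unfolding mult_1_left by (rule less_le_trans)
    then show ?thesis
      using that(1) by (simp add: conic_K_def blinfun.scaleR_right algebra_simps)
  qed
  with 1 2 show ?thesis by (simp add: co_radiant_def)
qed

end

theory Submission
  imports Defs
begin

text \<open>Since \<open>f\<close> is odd and the norm is even,
  \<open>f k - \<alpha> * norm k\<close> equals minus the value of \<open>conic_p f \<alpha>\<close>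
  at \<open>- k\<close>; as \<open>conic_p f \<alpha>\<close> is positively homogeneous, scaling by
  \<open>l\<close> moves the threshold from 1 to \<open>l\<close>. So the reflected dilated set is a
  strict sublevel set of \<open>conic_p f \<alpha>\<close> (\<open>uminus_dilate_conic_K\<close>),
  and efficiency of \<open>x\<close> says that no nonzero difference \<open>x' - x\<close> falls in
  it.\<close>

lemma uminus_dilate_conic_K:
  fixes f :: "'a::real_normed_vector \<Rightarrow>\<^sub>L real"
  assumes "l > 0"
  shows "uminus ` dilate (conic_K f \<alpha>) l = {v. conic_p f \<alpha> v < - l}"
proof (intro equalityI subsetI)
  fix v
  assume "v \<in> uminus ` dilate (conic_K f \<alpha>) l"
  then obtain k where k: "1 < blinfun_apply f k - \<alpha> * norm k" and v: "v = - (l *\<^sub>R k)"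
    by (auto simp: dilate_def conic_K_def)
  have "conic_p f \<alpha> v = - (l * (blinfun_apply f k - \<alpha> * norm k))"
    using assms
    by (simp add: v conic_p_def blinfun.minus_right blinfun.scaleR_right algebra_simps)
  moreover have "l * 1 < l * (blinfun_apply f k - \<alpha> * norm k)"
    using k assms by (rule mult_strict_left_mono)
  ultimately show "v \<in> {v. conic_p f \<alpha> v < - l}" by simp
next
  fix v
  assume "v \<in> {v. conic_p f \<alpha> v < - l}"
  then have v: "conic_p f \<alpha> v < - l" by simp
  \<comment> \<open>The only possible preimage of \<open>v\<close> under dilation by
    \<open>l\<close> followed by negation.\<close>
  define k where "k = - (inverse l *\<^sub>R v)"
  have "blinfun_apply f k - \<alpha> * norm k = - conic_p f \<alpha> v / l"
    using assms
    by (simp add: k_def conic_p_def blinfun.minus_right blinfun.scaleR_right field_simps)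
  also have "\<dots> > 1"
    using v assms by (simp add: field_simps)
  finally have "k \<in> conic_K f \<alpha>" by (simp add: conic_K_def)
  moreover have "v = - (l *\<^sub>R k)" using assms by (simp add: k_def)
  ultimately show "v \<in> uminus ` dilate (conic_K f \<alpha>) l"
    by (auto simp: dilate_def)
qed

theorem proposition5p3:
  fixes A :: "'a::real_normed_vector set"
    and f :: "'a \<Rightarrow>\<^sub>L real"
    and \<alpha> l :: real
  assumes "0 < \<alpha>" and "\<alpha> < norm f" and "l > 0"
  shows "AE A (conic_K f \<alpha>) l = {x \<in> A. \<forall>x'\<in>A. conic_p f \<alpha> (x' - x) \<ge> - l}"
proof -
  \<comment> \<open>The origin lies outside the sublevel set because \<open>- l < 0\<close>, so an
    intersection contained in \<open>{0}\<close> is in fact empty.\<close>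
  have "conic_p f \<alpha> 0 = 0" by (simp add: conic_p_def)
  with \<open>l > 0\<close> have "\<not> conic_p f \<alpha> v < - l" if "v = 0" for v
    using that by simp
  then show ?thesis
    unfolding AE_def uminus_dilate_conic_K[OF \<open>l > 0\<close>] by (fastforce simp: not_less)
qed

end
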